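(* For a class $\mathcal{F}$ of plane sets and $k\in\mathbb{N}$, let $\mathcal{F}^k(n)$ denote the largest $k$-CF-chromatic number of the intersection graph of a family of $n$ elements of $\mathcal{F}$. Then: (1) for the class $\mathcal{L}$ of L-shapes, $\mathcal{L}^k(n)=\Theta(\log n)$ for every fixed $k\ge 2$; (2) for the class $\mathcal{F}$ of frames, $\mathcal{F}^k(n)=\Theta(\log n)$ for every fixed $k\ge 4$.
   Context: An L-shape is a curve of the form $\{x\}\times[y_0,y_1]\ \cup\ [x,x']\times\{y_0\}$ with $y_0<y_1$, $x<x'$ (a vertical and a horizontal segment in the shape of the letter L). A frame is the boundary of an axis-parallel rectangle. The intersection graph of a family of sets has the sets as vertices, two adjacent iff they intersect. For a graph $G=(V,E)$ and $v\in V$, $N_G(v)=\{u:\{u,v\}\in E\}$. A $k$-CF-coloring of $G$ is a map $c:V\to\mathbb{N}$ such that for every $v$ with $N_G(v)\neq\emptyset$ there is a color $i$ with $1\le|N_G(v)\cap c^{-1}(i)|\le k$ (vertices with empty neighborhood impose no condition); the $k$-CF-chromatic number $\chi_{k\text{-cf}}(G)$ is the minimum number of colors in such a coloring. *)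

theory Defs
  imports "HOL-Analysis.Analysis" "HOL-Library.Landau_Symbols"
begin

type_synonym plane = "real \<times> real"

definition L_shapes :: "plane set set" where
  "L_shapes = {{x} \<times> {y0..y1} \<union> {x..x'} \<times> {y0} | x x' y0 y1. y0 < y1 \<and> x < x'}"

definition frames :: "plane set set" where
  "frames = {frontier ({a..b} \<times> {c..d}) | a b c d. a < b \<and> c < d}"

type_synonym 'v graph = "'v set \<times> 'v set set"

definition neighborhood :: "'v graph \<Rightarrow> 'v \<Rightarrow> 'v set" where
  "neighborhood G v = {u. {u, v} \<in> snd G}"

definition intersection_graph :: "'p set set \<Rightarrow> 'p set graph" where
  "intersection_graph S =
     (S, {{A, B} | A B. A \<in> S \<and> B \<in> S \<and> A \<noteq> B \<and> A \<inter> B \<noteq> {}})"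

definition cf_coloring :: "nat \<Rightarrow> 'v graph \<Rightarrow> ('v \<Rightarrow> nat) \<Rightarrow> bool" where
  "cf_coloring k G c \<longleftrightarrow>
     (\<forall>v \<in> fst G. neighborhood G v \<noteq> {} \<longrightarrow>
        (\<exists>i. 1 \<le> card (neighborhood G v \<inter> c -` {i}) \<and>
             card (neighborhood G v \<inter> c -` {i}) \<le> k))"

definition cf_chromatic_number :: "nat \<Rightarrow> 'v graph \<Rightarrow> nat" where
  "cf_chromatic_number k G = (LEAST m. \<exists>c. cf_coloring k G c \<and> card (c ` fst G) = m)"

definition max_cf_chromatic_number :: "'p set set \<Rightarrow> nat \<Rightarrow> nat \<Rightarrow> nat" where
  "max_cf_chromatic_number \<F> k n =
     Max {cf_chromatic_number k (intersection_graph S) | S. S \<subseteq> \<F> \<and> finite S \<and> card S = n}"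

text \<open>The minimum and the maximum above are taken over a nonempty set and a finite set,
  respectively, as soon as \<open>k \<ge> 1\<close>: an injective coloring is always admissible.\<close>

lemma inj_cf_coloring:
  assumes "finite S" "k \<ge> 1" "inj_on c S"
  shows "cf_coloring k (intersection_graph S) c"
  unfolding cf_coloring_def
proof (intro ballI impI)
  fix v
  let ?N = "neighborhood (intersection_graph S) v"
  assume "?N \<noteq> {}"
  then obtain u where u: "u \<in> ?N" by blast
  have sub: "?N \<subseteq> S"
    by (auto simp: neighborhood_def intersection_graph_def doubleton_eq_iff)
  have "?N \<inter> c -` {c u} = {u}"
    using u sub assms(3) by (auto dest: inj_onD)
  then show "\<exists>i. 1 \<le> card (?N \<inter> c -` {i}) \<and> card (?N \<inter> c -` {i}) \<le> k"
    using assms(2) by (intro exI[of _ "c u"]) simp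
qed

lemma cf_chromatic_number_le_card:
  assumes "finite S" "k \<ge> 1"
  shows "cf_chromatic_number k (intersection_graph S) \<le> card S"
proof -
  obtain c :: "'a set \<Rightarrow> nat" where c: "inj_on c S"
    using finite_imp_inj_to_nat_seg[OF assms(1)] by blast
  have "card (c ` fst (intersection_graph S)) = card S"
    using c by (simp add: intersection_graph_def card_image)
  with inj_cf_coloring[OF assms c] show ?thesis
    unfolding cf_chromatic_number_def by (intro Least_le) blast
qed

lemma finite_cf_chromatic_numbers:
  assumes "k \<ge> 1"
  shows "finite {cf_chromatic_number k (intersection_graph S) | S.
                   S \<subseteq> \<F> \<and> finite S \<and> card S = n}"
  by (rule finite_subset[of _ "{..n}"]) (use cf_chromatic_number_le_card[OF _ assms] in auto)

end

theory Submission
  imports Defs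
begin

text \<open>
  Upper bound. Two L-shapes, or two frames, meet iff a vertical side of one meets a horizontal
  side of the other; this remains true for collinear overlaps. So if every shape has \<open>q\<close>
  vertical and \<open>q\<close> horizontal sides, a neighborhood is the union of \<open>2q\<close> sets, each
  consisting of the shapes with a parallel side stabbed by one side of the given shape. Call two
  vertical sides of a subfamily close if some horizontal line meets both with at most \<open>q\<close> other
  sides in between. A sweep over the heights of the endpoints shows that there are linearly many
  close pairs, because each event creates at most \<open>(q + 2)\<^sup>2\<close> of them; the same holds for
  horizontal sides. Hence a positive fraction of every subfamily is independent with respect to
  both relations. Giving such a set a new color and recursing on the rest uses \<open>O(log n)\<close>
  colors, and in each stabbed set the maximal color occurs only once: two shapes of that color
  would be separated only by the at most \<open>q\<close> sides of the given shape itself, hence close.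
  The maximal color of a neighborhood thus occurs at most \<open>2q\<close> times.

  Lower bound. Thin vertical shapes act as points on a line and thin horizontal ones as
  intervals. Among \<open>(k + 1)\<^sup>t\<close> points cut into \<open>k + 1\<close> equal blocks, a color
  occurring at most \<open>k\<close> times is missing from some block, so each level of the recursion
  needs a further color.
\<close>

section \<open>Close pairs of parallel segments\<close>

text \<open>Replaces positions or event times, which may coincide, by distinct natural numbers; ties
  are broken arbitrarily. The induction adds elements by nondecreasing \<open>key\<close>, so a new
  element takes the last rank.\<close>

lemma finite_rank:
  fixes key :: "'b \<Rightarrow> 'k::linorder"
  assumes "finite B"
  shows "\<exists>r. bij_betw r B {..<card B} \<and> (\<forall>x\<in>B. \<forall>y\<in>B. key x < key y \<longrightarrow> r x < r y)"
  using assms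
proof (induction rule: finite_ranking_induct[where f = key])
  case empty
  then show ?case by (auto simp: bij_betw_def)
next
  case (insert x S)
  then obtain r where r: "bij_betw r S {..<card S}"
    "\<And>x y. x \<in> S \<Longrightarrow> y \<in> S \<Longrightarrow> key x < key y \<Longrightarrow> r x < r y" by blast
  show ?case
  proof (cases "x \<in> S")
    case True
    then show ?thesis using r by (auto simp: insert_absorb)
  next
    case False
    let ?r = "r(x := card S)"
    have lt: "r y < card S" if "y \<in> S" for y
      using r(1) that by (auto simp: bij_betw_def)
    have "bij_betw ?r S {..<card S}"
      using r(1) False by (subst bij_betw_cong[of S ?r r]) auto
    then have "bij_betw ?r (insert x S) (insert (?r x) {..<card S})"
      using False by (auto simp: bij_betw_def)
    then have "bij_betw ?r (insert x S) {..<card (insert x S)}"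
      using False insert.hyps(1) by (simp add: lessThan_Suc)
    moreover have "\<forall>u\<in>insert x S. \<forall>v\<in>insert x S. key u < key v \<longrightarrow> ?r u < ?r v"
      using r(2) lt insert.hyps(2) False by (auto simp: not_less[symmetric])
    ultimately show ?thesis by blast
  qed
qed

text \<open>The ranking makes the trace of every \<open>C y\<close> on \<open>E\<close> an initial
  segment, without computing when an element enters the chain. The key of \<open>e\<close> counts
  the elements of \<open>E\<close> that some member of the chain contains while omitting
  \<open>e\<close>. If \<open>C y\<close> contains \<open>e\<close> but not \<open>e'\<close>,
  everything counted for \<open>e\<close> already lies in \<open>C y\<close> and is counted for
  \<open>e'\<close> too, and \<open>e\<close> itself is counted in addition.\<close>

lemma chain_rank:
  fixes C :: "'y::linorder \<Rightarrow> 'e set"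
  assumes E: "finite E" and mono: "\<And>y z. y \<le> z \<Longrightarrow> C y \<subseteq> C z"
  shows "\<exists>r. bij_betw r E {..<card E} \<and> (\<forall>y. \<forall>e\<in>E. \<forall>e'\<in>E. e \<in> C y \<longrightarrow> e' \<notin> C y \<longrightarrow> r e < r e')"
proof -
  define key where "key e = card {e'\<in>E. \<exists>y. e' \<in> C y \<and> e \<notin> C y}" for e
  obtain r where r: "bij_betw r E {..<card E}"
    "\<forall>x\<in>E. \<forall>y\<in>E. key x < key y \<longrightarrow> r x < r y"
    using finite_rank[OF E, of key] by blast
  have "key e < key e'" if "e \<in> E" "e' \<in> E" "e \<in> C y" "e' \<notin> C y" for y e e'
  proof -
    have "{u\<in>E. \<exists>z. u \<in> C z \<and> e \<notin> C z} \<subset> {u\<in>E. \<exists>z. u \<in> C z \<and> e' \<notin> C z}"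
    proof
      show "{u\<in>E. \<exists>z. u \<in> C z \<and> e \<notin> C z} \<subseteq> {u\<in>E. \<exists>z. u \<in> C z \<and> e' \<notin> C z}"
      proof safe
        fix u z assume "u \<in> C z" "e \<notin> C z"
        then have "C z \<subseteq> C y" using mono[of z y] mono[of y z] that(3) linear[of y z] by blast
        then show "\<exists>z. u \<in> C z \<and> e' \<notin> C z" using \<open>u \<in> C z\<close> that by blast
      qed
      have "e \<in> {u\<in>E. \<exists>z. u \<in> C z \<and> e' \<notin> C z}" using that by blast
      then show "{u\<in>E. \<exists>z. u \<in> C z \<and> e \<notin> C z} \<noteq> {u\<in>E. \<exists>z. u \<in> C z \<and> e' \<notin> C z}"
        by blast
    qed
    then show ?thesis unfolding key_def using E by (intro psubset_card_mono) auto
  qed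
  then show ?thesis using r by blast
qed

section \<open>Counting close pairs by a sweep over the heights\<close>

definition near :: "nat \<Rightarrow> nat set \<Rightarrow> (nat \<times> nat) set" where
  "near q S = {(i, j). i \<in> S \<and> j \<in> S \<and> i < j \<and> card {m\<in>S. i < m \<and> m < j} \<le> q}"

text \<open>Moving \<open>i\<close> to the left strictly increases the number of elements between
  \<open>i\<close> and \<open>k\<close>, so this number identifies \<open>i\<close>, and it takes at
  most \<open>q + 1\<close> values.\<close>

lemma card_near_left:
  "card {i\<in>S. i < k \<and> card {m\<in>S. i < m \<and> m < (k::nat)} \<le> q} \<le> q + 1" (is "card ?L \<le> _")
proof -
  let ?f = "\<lambda>i. card {m\<in>S. i < m \<and> m < k}"
  have lt: "?f j < ?f i" if "i \<in> S" "j \<in> S" "i < j" "j < k" for i j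
    by (rule psubset_card_mono) (use that in auto)
  have "inj_on ?f ?L"
  proof (rule inj_onI)
    fix i j assume "i \<in> ?L" "j \<in> ?L" "?f i = ?f j"
    then show "i = j" using lt[of i j] lt[of j i] by (cases i j rule: linorder_cases) auto
  qed
  then have "card ?L = card (?f ` ?L)" by (simp add: card_image)
  also have "\<dots> \<le> card {..q}" by (intro card_mono) auto
  finally show ?thesis by simp
qed

lemma card_near_right:
  assumes "finite S"
  shows "card {j\<in>S. k < j \<and> card {m\<in>S. (k::nat) < m \<and> m < j} \<le> q} \<le> q + 1" (is "card ?L \<le> _")
proof -
  let ?f = "\<lambda>j. card {m\<in>S. k < m \<and> m < j}"
  have lt: "?f i < ?f j" if "i \<in> S" "j \<in> S" "i < j" "k < i" for i j
    by (rule psubset_card_mono) (use that in auto)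
  have "inj_on ?f ?L"
  proof (rule inj_onI)
    fix i j assume "i \<in> ?L" "j \<in> ?L" "?f i = ?f j"
    then show "i = j" using lt[of i j] lt[of j i] by (cases i j rule: linorder_cases) auto
  qed
  then have "card ?L = card (?f ` ?L)" by (simp add: card_image)
  also have "\<dots> \<le> card {..q}" by (intro card_mono) auto
  finally show ?thesis by simp
qed

text \<open>One event inserts or deletes a single bar \<open>k\<close>. A pair not straddling
  \<open>k\<close> has the same elements in between before and after, so a new close pair satisfies
  \<open>i \<le> k \<le> j\<close>. Each of its ends is then \<open>k\<close> or one of the at most
  \<open>q + 1\<close> elements close to \<open>k\<close> on that side, which gives
  \<open>q + 2\<close> choices for each end.\<close>

lemma card_near_diff:
  assumes "finite S" and eq: "S' - {k} = S - {k}"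
  shows "card (near q S' - near q S) \<le> (q + 2)\<^sup>2"
proof -
  let ?L = "{i\<in>S'. i < k \<and> card {m\<in>S'. i < m \<and> m < k} \<le> q}"
  let ?R = "{j\<in>S'. k < j \<and> card {m\<in>S'. k < m \<and> m < j} \<le> q}"
  have fin: "finite S'" using assms by (metis finite.emptyI finite_Diff finite_Diff2 finite_insert)
  have memb: "x \<in> S' \<longleftrightarrow> x \<in> S" if "x \<noteq> k" for x using eq that by blast
  have "near q S' - near q S \<subseteq> insert k ?L \<times> insert k ?R"
  proof
    fix z assume z: "z \<in> near q S' - near q S"
    obtain i j where ij: "z = (i, j)" by force
    have a: "i \<in> S'" "j \<in> S'" "i < j" "card {m\<in>S'. i < m \<and> m < j} \<le> q"
      and n: "(i, j) \<notin> near q S" using z by (auto simp: near_def ij)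
    have "i \<le> k \<and> k \<le> j"
    proof (rule ccontr)
      assume c: "\<not> (i \<le> k \<and> k \<le> j)"
      have "{m\<in>S'. i < m \<and> m < j} = {m\<in>S. i < m \<and> m < j}"
        using c memb by force
      moreover have "i \<in> S" "j \<in> S" using c memb a by auto
      ultimately show False using n a by (simp add: near_def)
    qed
    moreover have "card {m\<in>S'. i < m \<and> m < k} \<le> q" if "k \<le> j"
      using card_mono[of "{m\<in>S'. i < m \<and> m < j}" "{m\<in>S'. i < m \<and> m < k}"] fin a that by fastforce
    moreover have "card {m\<in>S'. k < m \<and> m < j} \<le> q" if "i \<le> k"
      using card_mono[of "{m\<in>S'. i < m \<and> m < j}" "{m\<in>S'. k < m \<and> m < j}"] fin a that by fastforce
    ultimately show "z \<in> insert k ?L \<times> insert k ?R" using a ij by auto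
  qed
  then have "card (near q S' - near q S) \<le> card (insert k ?L \<times> insert k ?R)"
    using fin by (intro card_mono) auto
  also have "\<dots> = card (insert k ?L) * card (insert k ?R)" by (rule card_cartesian_product)
  also have "\<dots> \<le> (q + 2) * (q + 2)"
  proof (rule mult_le_mono)
    show "card (insert k ?L) \<le> q + 2"
      using card_insert_le_m1[of "q + 2" ?L k] card_near_left[of S' k q] by simp
    show "card (insert k ?R) \<le> q + 2"
      using card_insert_le_m1[of "q + 2" ?R k] card_near_right[OF fin, of k q] by simp
  qed
  finally show ?thesis by (simp add: power2_eq_square)
qed

text \<open>Starting from the empty active set, the \<open>2 * N\<close> events change the active
  set one bar at a time, and by \<open>card_near_diff\<close> each adds at most
  \<open>(q + 2)\<^sup>2\<close> close pairs.\<close>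

lemma card_near_sweep:
  fixes lo hi :: "nat \<Rightarrow> real" and N :: nat
  defines "A \<equiv> \<lambda>y. {b. b < N \<and> lo b \<le> y \<and> y \<le> hi b}"
  shows "finite (\<Union>y. near q (A y)) \<and> card (\<Union>y. near q (A y)) \<le> (q + 2)\<^sup>2 * (2 * N)"
proof -
  \<comment> \<open>\<open>(b, False)\<close> is the event that bar \<open>b\<close> starts, \<open>(b, True)\<close> that it ends; \<open>C y\<close> is the
    set of events that precede height \<open>y\<close>.\<close>
  let ?E = "{..<N} \<times> (UNIV :: bool set)"
  define C where "C y = {(b, s). if s then hi b < y else lo b \<le> y}" for y
  define act where "act D = {b. b < N \<and> (b, False) \<in> D \<and> (b, True) \<notin> D}" for D
  have "C y \<subseteq> C z" if "y \<le> z" for y z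
    using that by (auto simp: C_def split: if_splits)
  then obtain r where r: "bij_betw r ?E {..<card ?E}"
    and rC: "\<forall>y. \<forall>e\<in>?E. \<forall>e'\<in>?E. e \<in> C y \<longrightarrow> e' \<notin> C y \<longrightarrow> r e < r e'"
    using chain_rank[of ?E C] by auto
  \<comment> \<open>Simultaneous events are carried out one by one in the order \<open>r\<close>.
    Some sets \<open>act (D t)\<close> may therefore occur at no height; it suffices that every
    \<open>A y\<close> is among them.\<close>
  define D where "D t = {e\<in>?E. r e < t}" for t
  have fact: "finite (act D)" for D by (simp add: act_def)
  have fnear: "finite (near q (act D))" for D
    by (rule finite_subset[of _ "{..<N} \<times> {..<N}"]) (auto simp: near_def act_def)
  have cardE: "card ?E = 2 * N" by (simp add: card_cartesian_product)
  have step: "card (near q (act (D (Suc t))) - near q (act (D t))) \<le> (q + 2)\<^sup>2" if "t < card ?E" for t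
  proof -
    have "t \<in> r ` ?E" using r that by (simp add: bij_betw_def)
    then obtain e where e: "e \<in> ?E" "r e = t" by blast
    have "D (Suc t) = insert e (D t)"
      using e r unfolding D_def bij_betw_def inj_on_def by (auto simp: less_Suc_eq simp del: mem_Sigma_iff)
    then have "act (D (Suc t)) - {fst e} = act (D t) - {fst e}"
      by (cases e) (auto simp: act_def)
    then show ?thesis by (intro card_near_diff fact)
  qed
  have bound: "card (\<Union>t\<le>T. near q (act (D t))) \<le> (q + 2)\<^sup>2 * T" if "T \<le> card ?E" for T
    using that
  proof (induction T)
    case 0
    have "act (D 0) = {}" by (auto simp: D_def act_def)
    then show ?case by (simp add: near_def)
  next
    case (Suc T)
    let ?U = "\<Union>t\<le>T. near q (act (D t))"
    have "(\<Union>t\<le>Suc T. near q (act (D t))) \<subseteq> ?U \<union> (near q (act (D (Suc T))) - near q (act (D T)))"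
      by (auto simp: le_Suc_eq)
    then have "card (\<Union>t\<le>Suc T. near q (act (D t)))
        \<le> card (?U \<union> (near q (act (D (Suc T))) - near q (act (D T))))"
      using fnear by (intro card_mono) auto
    also have "\<dots> \<le> card ?U + card (near q (act (D (Suc T))) - near q (act (D T)))"
      by (rule card_Un_le)
    also have "\<dots> \<le> (q + 2)\<^sup>2 * T + (q + 2)\<^sup>2"
      using Suc step[of T] by (intro add_mono) auto
    finally show ?case by simp
  qed
  have sub: "(\<Union>y. near q (A y)) \<subseteq> (\<Union>t\<le>card ?E. near q (act (D t)))"
  proof
    fix z assume "z \<in> (\<Union>y. near q (A y))"
    then obtain y where y: "z \<in> near q (A y)" by blast
    have Ay: "A y = act (C y \<inter> ?E)" by (auto simp: A_def act_def C_def)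
    have "\<exists>t\<le>card ?E. C y \<inter> ?E = D t"
    proof (cases "?E \<subseteq> C y")
      case True
      then have "C y \<inter> ?E = D (card ?E)"
        using r unfolding D_def bij_betw_def by blast
      then show ?thesis by blast
    next
      case False
      \<comment> \<open>The rank of the first event outside \<open>C y\<close>. Since
        \<open>r\<close> puts the events of \<open>C y\<close> before all others, exactly those
        precede it.\<close>
      define t where "t = Min (r ` (?E - C y))"
      have ne: "r ` (?E - C y) \<noteq> {}" "finite (r ` (?E - C y))" using False by auto
      obtain e where e: "e \<in> ?E - C y" "r e = t"
        using Min_in[OF ne(2,1)] unfolding t_def by auto
      have "C y \<inter> ?E = D t"
      proof (intro equalityI subsetI)
        fix x assume "x \<in> C y \<inter> ?E"
        then show "x \<in> D t" using rC e unfolding D_def by blast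
      next
        fix x assume x: "x \<in> D t"
        show "x \<in> C y \<inter> ?E"
        proof (rule ccontr)
          assume "x \<notin> C y \<inter> ?E"
          then have "t \<le> r x" unfolding t_def using x ne by (intro Min_le) (auto simp: D_def)
          then show False using x by (simp add: D_def)
        qed
      qed
      moreover have "t \<le> card ?E" using bij_betw_apply[OF r, of e] e by simp
      ultimately show ?thesis by blast
    qed
    then show "z \<in> (\<Union>t\<le>card ?E. near q (act (D t)))" using y Ay by auto
  qed
  have fin: "finite (\<Union>t\<le>card ?E. near q (act (D t)))" using fnear by auto
  show ?thesis
    using card_mono[OF fin sub] bound[of "card ?E"] finite_subset[OF sub fin] unfolding cardE by linarith
qed

text \<open>The displayed set consists of the bars crossed by the segment at height \<open>y\<close>
  from \<open>l\<close> to \<open>u\<close>; \<open>f\<close> gives the owner of a bar, and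
  \<open>Z\<close> is meant for the bars of the shape to which the segment belongs. Among the
  crossed pairs outside \<open>Z\<close> with different owners, take one of least rank difference.
  An active bar between its two members is also crossed, and its owner differs from one of theirs,
  so outside \<open>Z\<close> it would yield a closer pair. Hence all bars in between lie in
  \<open>Z\<close>, and the pair is close.\<close>

lemma bar_visibility:
  fixes X lo hi :: "'b \<Rightarrow> real" and f :: "'b \<Rightarrow> 'o"
  assumes B: "finite B"
  shows "\<exists>R\<subseteq>B \<times> B. card R \<le> (q + 2)\<^sup>2 * (2 * card B) \<and>
    (\<forall>l u y Z i j. finite Z \<longrightarrow> card Z \<le> q \<longrightarrow>
       {i, j} \<subseteq> {b\<in>B. l \<le> X b \<and> X b \<le> u \<and> lo b \<le> y \<and> y \<le> hi b} - Z \<longrightarrow> f i \<noteq> f j \<longrightarrow>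
       (\<exists>(i, j)\<in>R. {i, j} \<subseteq> {b\<in>B. l \<le> X b \<and> X b \<le> u \<and> lo b \<le> y \<and> y \<le> hi b} - Z \<and> f i \<noteq> f j))"
proof -
  define N where "N = card B"
  obtain r where r: "bij_betw r B {..<N}" and rX: "\<forall>x\<in>B. \<forall>y\<in>B. X x < X y \<longrightarrow> r x < r y"
    using finite_rank[OF B, of X] unfolding N_def by blast
  define g where "g = inv_into B r"
  have g: "g m \<in> B" "r (g m) = m" if "m < N" for m
    using r that unfolding g_def bij_betw_def by (auto simp: inv_into_into f_inv_into_f)
  have gr: "g (r b) = b" "r b < N" if "b \<in> B" for b
    using r that unfolding g_def bij_betw_def by auto
  define A where "A y = {m. m < N \<and> lo (g m) \<le> y \<and> y \<le> hi (g m)}" for y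
  define R where "R = map_prod g g ` (\<Union>y. near q (A y))"
  have sweep: "finite (\<Union>y. near q (A y))" "card (\<Union>y. near q (A y)) \<le> (q + 2)\<^sup>2 * (2 * N)"
    using card_near_sweep[of q N "lo \<circ> g" "hi \<circ> g"] unfolding A_def by simp_all
  have R1: "R \<subseteq> B \<times> B" using g by (auto simp: R_def near_def A_def)
  have R2: "card R \<le> (q + 2)\<^sup>2 * (2 * card B)"
    using card_image_le[OF sweep(1), of "map_prod g g"] sweep(2) unfolding R_def N_def by linarith
  have R3: "\<exists>(i, j)\<in>R. {i, j} \<subseteq> st - Z \<and> f i \<noteq> f j"
    if Z: "finite Z" "card Z \<le> q" and st: "st = {b\<in>B. l \<le> X b \<and> X b \<le> u \<and> lo b \<le> y \<and> y \<le> hi b}"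
      and ij0: "{i, j} \<subseteq> st - Z" "f i \<noteq> f j" for st l u y Z i j
  proof -
    define P where "P p \<longleftrightarrow> {fst p, snd p} \<subseteq> st - Z \<and> f (fst p) \<noteq> f (snd p) \<and> r (fst p) < r (snd p)" for p
    define d where "d p = r (snd p) - r (fst p)" for p
    have "i \<in> B" "j \<in> B" using ij0 st by auto
    then have "r i \<noteq> r j" using gr(1) ij0(2) by metis
    then have "P (i, j) \<or> P (j, i)" using ij0 by (auto simp: P_def)
    then obtain p where p: "P p" and pmin: "\<And>p'. P p' \<Longrightarrow> d p \<le> d p'"
      using ex_has_least_nat[of P _ d] by blast
    obtain i j where pe: "p = (i, j)" by force
    have ij: "i \<in> st" "i \<notin> Z" "j \<in> st" "j \<notin> Z" "f i \<noteq> f j" "r i < r j" using p pe by (auto simp: P_def)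
    let ?M = "{m\<in>A y. r i < m \<and> m < r j}"
    have "g ` ?M \<subseteq> Z"
    proof
      fix b assume "b \<in> g ` ?M"
      then obtain m where m: "b = g m" "m \<in> A y" "r i < m" "m < r j" by blast
      have b: "b \<in> B" "r b = m" using m g by (auto simp: A_def)
      have "X i \<le> X b" "X b \<le> X j"
        using rX[rule_format, of b i] rX[rule_format, of j b] b m ij st by (auto simp: not_less[symmetric])
      then have bst: "b \<in> st" using m b ij unfolding st A_def by auto
      show "b \<in> Z"
      proof (rule ccontr)
        assume "b \<notin> Z"
        then have "P (i, b) \<or> P (b, j)" using ij m b bst by (auto simp: P_def)
        then show False using pmin[of "(i, b)"] pmin[of "(b, j)"] m b unfolding pe by (auto simp: d_def)
      qed
    qed
    moreover have "inj_on g ?M"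
      by (rule inj_on_inverseI[of _ r]) (auto simp: A_def g)
    ultimately have "card ?M \<le> q" using card_inj_on_le[of g ?M Z] Z by linarith
    moreover have "r i \<in> A y" "r j \<in> A y" using ij gr unfolding st A_def by auto
    ultimately have "(r i, r j) \<in> near q (A y)" using ij by (auto simp: near_def)
    then have "map_prod g g (r i, r j) \<in> R" unfolding R_def by blast
    then have "(i, j) \<in> R" using ij gr st by simp
    then show ?thesis using ij by (intro bexI[of _ "(i, j)"]) auto
  qed
  show ?thesis
    by (intro exI[of _ R] conjI allI impI R1 R2) (rule R3[OF _ _ refl]; assumption)
qed

section \<open>Coloring by independent sets\<close>

text \<open>The average degree is at most \<open>D\<close>, so at least half of the vertices, the
  set \<open>W\<close>, have degree at most \<open>2 * D\<close>. A maximal independent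
  \<open>U\<close> inside \<open>W\<close> dominates \<open>W\<close>, and each of its vertices
  covers at most \<open>2 * D + 1\<close> elements. Therefore
  \<open>card T \<le> 2 * card W \<le> 2 * (2 * D + 1) * card U\<close>.\<close>

lemma large_independent_set:
  assumes T: "finite T" and R: "R \<subseteq> T \<times> T" "sym R" and card: "card R \<le> D * card T"
  shows "\<exists>U\<subseteq>T. card T \<le> (4 * D + 2) * card U \<and> (\<forall>u\<in>U. \<forall>v\<in>U. u \<noteq> v \<longrightarrow> (u, v) \<notin> R)"
proof -
  define W where "W = {v\<in>T. card (R `` {v}) \<le> 2 * D}"
  have finR: "finite R" using T R finite_subset by blast
  have fin: "finite (R `` {v})" for v using finR by (rule finite_Image)
  have R_eq: "R = Sigma T (\<lambda>v. R `` {v})" using R by auto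
  have "card R = (\<Sum>v\<in>T. card (R `` {v}))"
    by (subst R_eq, subst card_SigmaI) (use T fin in auto)
  moreover have "(\<Sum>v\<in>T - W. 2 * D + 1) \<le> (\<Sum>v\<in>T - W. card (R `` {v}))"
    by (intro sum_mono) (auto simp: W_def)
  moreover have "(\<Sum>v\<in>T - W. card (R `` {v})) \<le> (\<Sum>v\<in>T. card (R `` {v}))"
    using T by (intro sum_mono2) auto
  ultimately have *: "(2 * D + 1) * card (T - W) \<le> D * card T" using card by (simp add: mult.commute)
  have cT: "card T = card W + card (T - W)"
    using card_Diff_subset[of W T] card_mono[of T W] T by (auto simp: W_def)
  have "card (T - W) \<le> card W"
  proof (rule ccontr)
    assume "\<not> ?thesis"
    then have "D * card W \<le> D * card (T - W)" "0 < card (T - W)" by (auto intro: mult_le_mono2)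
    moreover have "card (T - W) + D * card (T - W) \<le> D * card W"
      using * unfolding cT by (simp add: algebra_simps)
    ultimately show False by linarith
  qed
  then have W: "card T \<le> 2 * card W" using cT by simp
  define I where "I = {U. U \<subseteq> W \<and> (\<forall>u\<in>U. \<forall>v\<in>U. u \<noteq> v \<longrightarrow> (u, v) \<notin> R)}"
  have finW: "finite W" using T by (simp add: W_def)
  have "finite I" "{} \<in> I" unfolding I_def using finW by auto
  then obtain U where U: "U \<in> I" and max: "\<And>U'. U' \<in> I \<Longrightarrow> U \<subseteq> U' \<Longrightarrow> U = U'"
    using finite_has_maximal[of I] by blast
  have UW: "U \<subseteq> W" using U by (simp add: I_def)
  then have finU: "finite U" using finW finite_subset by blast
  have "W \<subseteq> (\<Union>u\<in>U. insert u (R `` {u}))"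
  proof
    fix w assume w: "w \<in> W"
    show "w \<in> (\<Union>u\<in>U. insert u (R `` {u}))"
    proof (rule ccontr)
      assume n: "w \<notin> (\<Union>u\<in>U. insert u (R `` {u}))"
      then have "insert w U \<in> I" using U w R(2) by (auto simp: I_def dest: symD)
      then show False using max[of "insert w U"] n by auto
    qed
  qed
  then have "card W \<le> card (\<Union>u\<in>U. insert u (R `` {u}))"
    using finU fin by (intro card_mono) auto
  also have "\<dots> \<le> (\<Sum>u\<in>U. card (insert u (R `` {u})))" by (rule card_UN_le[OF finU])
  also have "\<dots> \<le> (\<Sum>u\<in>U. 2 * D + 1)"
  proof (intro sum_mono)
    fix u assume "u \<in> U"
    then have "card (R `` {u}) \<le> 2 * D" using UW by (auto simp: W_def)
    then show "card (insert u (R `` {u})) \<le> 2 * D + 1"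
      using card_insert_if[OF fin[of u], of u] by auto
  qed
  finally have "card W \<le> (2 * D + 1) * card U" by (simp add: mult.commute)
  then have "card T \<le> (4 * D + 2) * card U" using W by simp
  moreover have "U \<subseteq> T" using UW by (auto simp: W_def)
  ultimately show ?thesis using U by (intro exI[of _ U]) (simp add: I_def)
qed

text \<open>The set \<open>U\<close> receives color 0 and the colors of the rest are shifted up by
  one. If 0 bounds the colors on a hyperedge, the hyperedge lies in \<open>U\<close>; otherwise its
  highest color class is inherited from \<open>S - U\<close>. Each round shrinks the set by the
  factor \<open>(C - 1) / C\<close>, hence the logarithmic bound. The number \<open>i\<close> in the
  conclusion is only an upper bound and need not be attained, so that one \<open>i\<close> can serve
  several hyperedges at once.\<close>

lemma unique_maximum_coloring:
  assumes "finite S" and C: "C \<ge> 2"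
    and step: "\<forall>T\<subseteq>S. T \<noteq> {} \<longrightarrow>
      (\<exists>U\<subseteq>T. card T \<le> C * card U \<and> (\<forall>h\<in>\<H>. h \<inter> T \<subseteq> U \<longrightarrow> card (h \<inter> T) \<le> 1))"
  shows "\<exists>c :: 'a \<Rightarrow> nat. \<exists>m. c ` S \<subseteq> {..<m} \<and> real m \<le> 1 + ln (card S) / ln (real C / (real C - 1)) \<and>
    (\<forall>h\<in>\<H>. \<forall>i. (\<forall>x\<in>h \<inter> S. c x \<le> i) \<longrightarrow> card (h \<inter> S \<inter> c -` {i}) \<le> 1)"
  using \<open>finite S\<close> step
proof (induction S rule: finite_psubset_induct)
  case (psubset S)
  define b where "b = real C / (real C - 1)"
  have b: "b > 1" using C by (simp add: b_def)
  show ?case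
  proof (cases "S = {}")
    case True
    \<comment> \<open>Here \<open>card S = 0\<close>, and the convention \<open>ln 0 = 0\<close>
      turns the bound into 1.\<close>
    then show ?thesis by (intro exI[of _ "\<lambda>_. 0"] exI[of _ 0]) simp
  next
    case False
    from psubset.prems[rule_format, OF order_refl False]
    obtain U where U: "U \<subseteq> S" "card S \<le> C * card U"
      and Uh: "\<forall>h\<in>\<H>. h \<inter> S \<subseteq> U \<longrightarrow> card (h \<inter> S) \<le> 1"
      by (elim exE conjE)
    have cS: "card S > 0" using False psubset.hyps by (simp add: card_gt_0_iff)
    have "U \<noteq> {}" using U cS by auto
    then have ps: "S - U \<subset> S" using U by blast
    have "\<forall>T\<subseteq>S - U. T \<noteq> {} \<longrightarrow>
        (\<exists>U\<subseteq>T. card T \<le> C * card U \<and> (\<forall>h\<in>\<H>. h \<inter> T \<subseteq> U \<longrightarrow> card (h \<inter> T) \<le> 1))"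
      using psubset.prems by (meson Diff_subset order_trans)
    from psubset.IH[OF ps this] obtain c :: "'a \<Rightarrow> nat" and m where c: "c ` (S - U) \<subseteq> {..<m}" "real m \<le> 1 + ln (card (S - U)) / ln b"
      and ch: "\<forall>h\<in>\<H>. \<forall>i. (\<forall>x\<in>h \<inter> (S - U). c x \<le> i) \<longrightarrow> card (h \<inter> (S - U) \<inter> c -` {i}) \<le> 1"
      unfolding b_def by (elim exE conjE)
    define c' where "c' x = (if x \<in> U then 0 else Suc (c x))" for x
    have hyper: "card (h \<inter> S \<inter> c' -` {i}) \<le> 1" if "h \<in> \<H>" "\<forall>x\<in>h \<inter> S. c' x \<le> i" for h i
    proof (cases i)
      case 0
      then have "h \<inter> S \<subseteq> U" using that(2) by (auto simp: c'_def split: if_splits)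
      then have "card (h \<inter> S) \<le> 1" by (rule Uh[rule_format, OF that(1)])
      moreover have "card (h \<inter> S \<inter> c' -` {i}) \<le> card (h \<inter> S)"
        using psubset.hyps by (intro card_mono) auto
      ultimately show ?thesis by simp
    next
      case (Suc i')
      then have "h \<inter> S \<inter> c' -` {i} = h \<inter> (S - U) \<inter> c -` {i'}"
        by (auto simp: c'_def split: if_splits)
      moreover have "\<forall>x\<in>h \<inter> (S - U). c x \<le> i'"
        using that(2) Suc by (fastforce simp: c'_def split: if_splits)
      ultimately show ?thesis using ch that(1) by simp
    qed
    \<comment> \<open>The case where \<open>U\<close> exhausts \<open>S\<close> is separate:
      comparing the two bounds requires the logarithm of a positive
      \<open>card (S - U)\<close>.\<close>
    show ?thesis
    proof (cases "S - U = {}")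
      case True
      then have "c' ` S \<subseteq> {..<1}" by (auto simp: c'_def)
      moreover have "real 1 \<le> 1 + ln (card S) / ln b" using b cS by simp
      ultimately show ?thesis
        using hyper by (intro exI[of _ c'] exI[of _ 1]) (auto simp: b_def)
    next
      case False
      have cSU: "card (S - U) > 0" using False psubset.hyps by (simp add: card_gt_0_iff)
      have "card S = card U + card (S - U)"
        using U psubset.hyps by (metis card_Diff_subset card_mono finite_subset le_add_diff_inverse)
      then have "real (card S) \<le> real C * (real (card S) - real (card (S - U)))"
        using U(2) by (metis add_diff_cancel_right' of_nat_add of_nat_le_iff of_nat_mult)
      then have "b * real (card (S - U)) \<le> card S"
        using C by (simp add: b_def field_simps)
      then have "ln (b * real (card (S - U))) \<le> ln (real (card S))"
        using b cSU cS by (subst ln_le_cancel_iff) auto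
      then have "ln b + ln (real (card (S - U))) \<le> ln (real (card S))"
        using b cSU by (simp add: ln_mult)
      then have "(ln b + ln (real (card (S - U)))) / ln b \<le> ln (real (card S)) / ln b"
        using b by (intro divide_right_mono) auto
      then have "1 + ln (real (card (S - U))) / ln b \<le> ln (real (card S)) / ln b"
        using b by (simp add: add_divide_distrib)
      then have "real (Suc m) \<le> 1 + ln (card S) / ln b" using c(2) by simp
      moreover have "c' ` S \<subseteq> {..<Suc m}" using c(1) by (auto simp: c'_def)
      ultimately show ?thesis
        using hyper by (intro exI[of _ c'] exI[of _ "Suc m"]) (auto simp: b_def)
    qed
  qed
qed

text \<open>The \<open>s\<close>-th of \<open>q\<close> parallel sides of the shape \<open>a\<close>
  is at position \<open>X a s\<close> and extends from \<open>lo a s\<close> to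
  \<open>hi a s\<close>. Read with the coordinates exchanged, the same definition describes
  horizontal sides stabbed by a vertical segment.\<close>

definition stabbed :: "nat \<Rightarrow> ('o \<Rightarrow> nat \<Rightarrow> real) \<Rightarrow> ('o \<Rightarrow> nat \<Rightarrow> real) \<Rightarrow> ('o \<Rightarrow> nat \<Rightarrow> real) \<Rightarrow>
    real \<Rightarrow> real \<Rightarrow> real \<Rightarrow> 'o set" where
  "stabbed q X lo hi l u y = {a. \<exists>s<q. l \<le> X a s \<and> X a s \<le> u \<and> lo a s \<le> y \<and> y \<le> hi a s}"

text \<open>Passes from sides to shapes. The bars are the pairs in \<open>T \<times> {..<q}\<close>,
  the owner is the first component, and the ignored set consists of the \<open>q\<close> sides of
  \<open>v\<close>; the close pairs are then projected to their owners. The factor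
  \<open>2 * q\<close> comes from two events for each of \<open>q\<close> bars per shape.\<close>

lemma stabbed_visibility:
  assumes T: "finite T"
  shows "\<exists>R\<subseteq>T \<times> T. card R \<le> 2 * q * (q + 2)\<^sup>2 * card T \<and>
    (\<forall>l u y v a b. {a, b} \<subseteq> stabbed q X lo hi l u y \<inter> T - {v} \<longrightarrow> a \<noteq> b \<longrightarrow>
       (\<exists>(a, b)\<in>R. {a, b} \<subseteq> stabbed q X lo hi l u y \<inter> T - {v} \<and> a \<noteq> b))"
proof -
  let ?B = "T \<times> {..<q}"
  let ?st = "\<lambda>l u y. {b\<in>?B. l \<le> case_prod X b \<and> case_prod X b \<le> u \<and> case_prod lo b \<le> y \<and> y \<le> case_prod hi b}"
  have "finite ?B" using T by simp
  from bar_visibility[OF this, of q "case_prod X" "case_prod lo" "case_prod hi" fst]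
  obtain R where R: "R \<subseteq> ?B \<times> ?B" "card R \<le> (q + 2)\<^sup>2 * (2 * card ?B)"
    and vis: "\<forall>l u y Z i j. finite Z \<longrightarrow> card Z \<le> q \<longrightarrow> {i, j} \<subseteq> ?st l u y - Z \<longrightarrow> fst i \<noteq> fst j \<longrightarrow>
       (\<exists>(i, j)\<in>R. {i, j} \<subseteq> ?st l u y - Z \<and> fst i \<noteq> fst j)"
    by (elim exE conjE)
  have finR: "finite R" using R(1) T finite_subset by blast
  let ?R = "map_prod fst fst ` R"
  have "?R \<subseteq> T \<times> T" using R by auto
  moreover have "card ?R \<le> 2 * q * (q + 2)\<^sup>2 * card T"
    using card_image_le[OF finR, of "map_prod fst fst"] R(2) by (simp add: card_cartesian_product ac_simps)
  moreover have "\<exists>(a, b)\<in>?R. {a, b} \<subseteq> stabbed q X lo hi l u y \<inter> T - {v} \<and> a \<noteq> b"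
    if ab: "{a, b} \<subseteq> stabbed q X lo hi l u y \<inter> T - {v}" "a \<noteq> b" for l u y v a b
  proof -
    obtain s t where st: "(a, s) \<in> ?st l u y - {v} \<times> {..<q}" "(b, t) \<in> ?st l u y - {v} \<times> {..<q}"
      using ab(1) by (auto simp: stabbed_def)
    have "\<exists>(i, j)\<in>R. {i, j} \<subseteq> ?st l u y - {v} \<times> {..<q} \<and> fst i \<noteq> fst j"
      by (rule vis[rule_format, of _ "(a, s)" "(b, t)"]) (use st ab(2) in \<open>auto simp: card_cartesian_product\<close>)
    then obtain i j where ij: "(i, j) \<in> R" "{i, j} \<subseteq> ?st l u y - {v} \<times> {..<q}" "fst i \<noteq> fst j"
      by (elim bexE case_prodE conjE) simp
    have "{fst i, fst j} \<subseteq> stabbed q X lo hi l u y \<inter> T - {v}"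
      using ij(2) by (auto simp: stabbed_def)
    moreover have "(fst i, fst j) \<in> ?R" using ij(1) by force
    ultimately show ?thesis using ij(3) by (intro bexI[of _ "(fst i, fst j)"]) auto
  qed
  ultimately show ?thesis by (intro exI[of _ ?R] conjI allI impI)
qed

text \<open>Take \<open>U\<close> independent for the close pairs of both directions: a stabbed set
  inside \<open>U\<close> with two members would contain such a pair. Each direction gives at most
  \<open>2 * q * (q + 2)\<^sup>2 * card T\<close> pairs; uniting the two and symmetrizing costs a
  factor 4. So \<open>large_independent_set\<close> applies with
  \<open>D = 8 * q * (q + 2)\<^sup>2\<close>, and the constant is \<open>4 * D + 2\<close>.\<close>

lemma stabbed_independent:
  fixes T :: "'o set"
  assumes T: "finite T"
  shows "\<exists>U\<subseteq>T. card T \<le> (32 * q * (q + 2)\<^sup>2 + 2) * card U \<and>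
    (\<forall>h \<in> {stabbed q X lo hi l u y - {v} | l u y v. True} \<union> {stabbed q X' lo' hi' l u y - {v} | l u y v. True}.
       h \<inter> T \<subseteq> U \<longrightarrow> card (h \<inter> T) \<le> 1)"
proof -
  let ?K = "2 * q * (q + 2)\<^sup>2"
  from stabbed_visibility[OF T, of q X lo hi]
  obtain R1 where R1: "R1 \<subseteq> T \<times> T" "card R1 \<le> ?K * card T"
    and vis1: "\<forall>l u y v a b. {a, b} \<subseteq> stabbed q X lo hi l u y \<inter> T - {v} \<longrightarrow> a \<noteq> b \<longrightarrow>
       (\<exists>(a, b)\<in>R1. {a, b} \<subseteq> stabbed q X lo hi l u y \<inter> T - {v} \<and> a \<noteq> b)"
    by (elim exE conjE)
  from stabbed_visibility[OF T, of q X' lo' hi']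
  obtain R2 where R2: "R2 \<subseteq> T \<times> T" "card R2 \<le> ?K * card T"
    and vis2: "\<forall>l u y v a b. {a, b} \<subseteq> stabbed q X' lo' hi' l u y \<inter> T - {v} \<longrightarrow> a \<noteq> b \<longrightarrow>
       (\<exists>(a, b)\<in>R2. {a, b} \<subseteq> stabbed q X' lo' hi' l u y \<inter> T - {v} \<and> a \<noteq> b)"
    by (elim exE conjE)
  define R where "R = (R1 \<union> R2) \<union> (R1 \<union> R2)\<inverse>"
  have "card R \<le> card (R1 \<union> R2) + card ((R1 \<union> R2)\<inverse>)" unfolding R_def by (rule card_Un_le)
  also have "\<dots> = 2 * card (R1 \<union> R2)" by simp
  also have "\<dots> \<le> 2 * (card R1 + card R2)" by (intro mult_left_mono card_Un_le) auto
  also have "\<dots> \<le> (4 * ?K) * card T" using R1(2) R2(2) by simp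
  finally have cR: "card R \<le> (4 * ?K) * card T" .
  have "R \<subseteq> T \<times> T" using R1 R2 by (auto simp: R_def)
  moreover have "sym R" unfolding R_def by (rule sym_Un_converse)
  ultimately obtain U where U: "U \<subseteq> T" "card T \<le> (4 * (4 * ?K) + 2) * card U"
    and ind: "\<And>u v. u \<in> U \<Longrightarrow> v \<in> U \<Longrightarrow> u \<noteq> v \<Longrightarrow> (u, v) \<notin> R"
    using large_independent_set[OF T _ _ cR] by blast
  have le1: "card H \<le> 1" if "H \<subseteq> U"
    and vis: "\<And>a b. {a, b} \<subseteq> H \<Longrightarrow> a \<noteq> b \<Longrightarrow> \<exists>(a, b)\<in>R1 \<union> R2. {a, b} \<subseteq> H \<and> a \<noteq> b" for H
  proof (rule ccontr)
    assume "\<not> card H \<le> 1"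
    then obtain a b where "{a, b} \<subseteq> H" "a \<noteq> b" using card_le_Suc0_iff_eq[of H]
      by (metis One_nat_def card.infinite empty_subsetI insert_subset le_zero_eq linear)
    then obtain a b where "(a, b) \<in> R1 \<union> R2" "{a, b} \<subseteq> H" "a \<noteq> b" using vis by blast
    then show False using ind[of a b] \<open>H \<subseteq> U\<close> by (auto simp: R_def)
  qed
  have h1: "card (h \<inter> T) \<le> 1" if h: "h = stabbed q X lo hi l u y - {v}" and sub: "h \<inter> T \<subseteq> U" for h l u y v
  proof (rule le1[OF sub])
    have e: "h \<inter> T = stabbed q X lo hi l u y \<inter> T - {v}" using h by blast
    show "\<exists>(a, b)\<in>R1 \<union> R2. {a, b} \<subseteq> h \<inter> T \<and> a \<noteq> b" if "{a, b} \<subseteq> h \<inter> T" "a \<noteq> b" for a b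
      using vis1[rule_format, of a b l u y v] that unfolding e by blast
  qed
  have h2: "card (h \<inter> T) \<le> 1" if h: "h = stabbed q X' lo' hi' l u y - {v}" and sub: "h \<inter> T \<subseteq> U" for h l u y v
  proof (rule le1[OF sub])
    have e: "h \<inter> T = stabbed q X' lo' hi' l u y \<inter> T - {v}" using h by blast
    show "\<exists>(a, b)\<in>R1 \<union> R2. {a, b} \<subseteq> h \<inter> T \<and> a \<noteq> b" if "{a, b} \<subseteq> h \<inter> T" "a \<noteq> b" for a b
      using vis2[rule_format, of a b l u y v] that unfolding e by blast
  qed
  have cT: "card T \<le> (32 * q * (q + 2)\<^sup>2 + 2) * card U" using U(2) by (simp add: ac_simps)
  show ?thesis
  proof (intro exI[of _ U] conjI ballI impI U(1) cT)
    fix h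
    assume "h \<in> {stabbed q X lo hi l u y - {v} | l u y v. True} \<union> {stabbed q X' lo' hi' l u y - {v} | l u y v. True}"
      and sub: "h \<inter> T \<subseteq> U"
    then show "card (h \<inter> T) \<le> 1"
      by (elim UnE CollectE exE conjE) (erule h1[OF _ sub], erule h2[OF _ sub])
  qed
qed

section \<open>From hyperedges to conflict-free colorings of intersection graphs\<close>

lemma neighborhood_intersection_graph:
  assumes "A \<in> S"
  shows "neighborhood (intersection_graph S) A = {B\<in>S. B \<noteq> A \<and> A \<inter> B \<noteq> {}}"
  using assms by (auto simp: neighborhood_def intersection_graph_def doubleton_eq_iff)

lemma cf_chromatic_number_le:
  assumes "cf_coloring k (intersection_graph S) c"
  shows "cf_chromatic_number k (intersection_graph S) \<le> card (c ` S)"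
  unfolding cf_chromatic_number_def
  using assms by (intro Least_le) (auto simp: intersection_graph_def)

text \<open>In \<open>meet\<close>, the first alternative says that horizontal side \<open>t\<close>
  of \<open>A\<close> meets vertical side \<open>s\<close> of \<open>B\<close>, the second that
  vertical side \<open>t\<close> of \<open>A\<close> meets horizontal side \<open>s\<close> of
  \<open>B\<close>. A neighborhood is thus a union of \<open>2 * q\<close> stabbed sets, each
  containing at most one shape of the maximal color of the whole neighborhood.\<close>

lemma cf_chromatic_number_rectilinear:
  fixes S :: "'p set set" and vx vlo vhi hy hlo hhi :: "'p set \<Rightarrow> nat \<Rightarrow> real"
  assumes S: "finite S" and k: "2 * q \<le> k"
    and meet: "\<And>A B. A \<in> S \<Longrightarrow> B \<in> S \<Longrightarrow> A \<inter> B \<noteq> {} \<longleftrightarrow>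
      (\<exists>s<q. \<exists>t<q.
        hlo A t \<le> vx B s \<and> vx B s \<le> hhi A t \<and> vlo B s \<le> hy A t \<and> hy A t \<le> vhi B s \<or>
        hlo B s \<le> vx A t \<and> vx A t \<le> hhi B s \<and> vlo A t \<le> hy B s \<and> hy B s \<le> vhi A t)"
  defines "C \<equiv> real (32 * q * (q + 2)\<^sup>2 + 2)"
  shows "real (cf_chromatic_number k (intersection_graph S)) \<le> 1 + ln (card S) / ln (C / (C - 1))"
proof -
  let ?\<H> = "{stabbed q vx vlo vhi l u y - {v} | l u y v. True} \<union> {stabbed q hy hlo hhi l u y - {v} | l u y v. True}"
  have "\<forall>T\<subseteq>S. T \<noteq> {} \<longrightarrow>
      (\<exists>U\<subseteq>T. card T \<le> (32 * q * (q + 2)\<^sup>2 + 2) * card U \<and> (\<forall>h\<in>?\<H>. h \<inter> T \<subseteq> U \<longrightarrow> card (h \<inter> T) \<le> 1))"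
    by (intro allI impI stabbed_independent) (use S finite_subset in blast)
  from unique_maximum_coloring[OF S le_add2 this] obtain c :: "'p set \<Rightarrow> nat" and m where c: "c ` S \<subseteq> {..<m}" "real m \<le> 1 + ln (card S) / ln (C / (C - 1))"
    and ch: "\<forall>h\<in>?\<H>. \<forall>i. (\<forall>x\<in>h \<inter> S. c x \<le> i) \<longrightarrow> card (h \<inter> S \<inter> c -` {i}) \<le> 1"
    unfolding C_def by (elim exE conjE)
  have "cf_coloring k (intersection_graph S) c"
    unfolding cf_coloring_def
  proof (intro ballI impI)
    fix A assume "A \<in> fst (intersection_graph S)"
    then have A: "A \<in> S" by (simp add: intersection_graph_def)
    define N where "N = neighborhood (intersection_graph S) A"
    assume "neighborhood (intersection_graph S) A \<noteq> {}"
    then have N: "N \<noteq> {}" by (simp add: N_def)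
    have finN: "finite N" using S by (simp add: N_def neighborhood_intersection_graph[OF A])
    \<comment> \<open>The shape \<open>A\<close> may be stabbed by its own sides but is not its own
      neighbor, which is why the hyperedges have one shape removed.\<close>
    define f where "f t = stabbed q vx vlo vhi (hlo A t) (hhi A t) (hy A t) - {A}" for t
    define g where "g t = stabbed q hy hlo hhi (vlo A t) (vhi A t) (vx A t) - {A}" for t
    have N_eq: "N = (\<Union>t<q. f t \<inter> S) \<union> (\<Union>t<q. g t \<inter> S)"
    proof (rule set_eqI)
      fix B
      show "B \<in> N \<longleftrightarrow> B \<in> (\<Union>t<q. f t \<inter> S) \<union> (\<Union>t<q. g t \<inter> S)"
      proof (cases "B \<in> S \<and> B \<noteq> A")
        case True
        then have "B \<in> N \<longleftrightarrow> A \<inter> B \<noteq> {}" by (simp add: N_def neighborhood_intersection_graph[OF A])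
        also note meet[OF A, of B]
        finally show ?thesis using True by (simp add: f_def g_def stabbed_def) blast
      next
        case False
        then show ?thesis by (auto simp: f_def g_def N_def neighborhood_intersection_graph[OF A])
      qed
    qed
    \<comment> \<open>The maximum is over the whole neighborhood. A single piece may miss the color
      \<open>i\<close>, but \<open>i\<close> still bounds the colors there, as \<open>ch\<close>
      requires.\<close>
    define i where "i = Max (c ` N)"
    have i: "c x \<le> i" if "x \<in> N" for x using that finN by (simp add: i_def)
    have f1: "card (f t \<inter> S \<inter> c -` {i}) \<le> 1" if "t < q" for t
    proof (rule ch[rule_format])
      show "f t \<in> ?\<H>" unfolding f_def by blast
      show "c x \<le> i" if "x \<in> f t \<inter> S" for x using \<open>t < q\<close> that by (intro i) (auto simp: N_eq)
    qed
    have g1: "card (g t \<inter> S \<inter> c -` {i}) \<le> 1" if "t < q" for t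
    proof (rule ch[rule_format])
      show "g t \<in> ?\<H>" unfolding g_def by blast
      show "c x \<le> i" if "x \<in> g t \<inter> S" for x using \<open>t < q\<close> that by (intro i) (auto simp: N_eq)
    qed
    have "N \<inter> c -` {i} = (\<Union>t<q. f t \<inter> S \<inter> c -` {i}) \<union> (\<Union>t<q. g t \<inter> S \<inter> c -` {i})"
      unfolding N_eq by blast
    then have "card (N \<inter> c -` {i}) \<le> card (\<Union>t<q. f t \<inter> S \<inter> c -` {i}) + card (\<Union>t<q. g t \<inter> S \<inter> c -` {i})"
      by (simp add: card_Un_le)
    also have "\<dots> \<le> (\<Sum>t<q. card (f t \<inter> S \<inter> c -` {i})) + (\<Sum>t<q. card (g t \<inter> S \<inter> c -` {i}))"
      by (intro add_mono card_UN_le) auto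
    also have "\<dots> \<le> (\<Sum>t<q. 1) + (\<Sum>t<q. 1)"
      using f1 g1 by (intro add_mono sum_mono) auto
    finally have "card (N \<inter> c -` {i}) \<le> k" using k by simp
    moreover have "i \<in> c ` N" unfolding i_def using N finN by (intro Max_in) auto
    then have "N \<inter> c -` {i} \<noteq> {}" by auto
    then have "1 \<le> card (N \<inter> c -` {i})" using finN by (simp add: Suc_le_eq card_gt_0_iff)
    ultimately show "\<exists>i. 1 \<le> card (neighborhood (intersection_graph S) A \<inter> c -` {i}) \<and>
        card (neighborhood (intersection_graph S) A \<inter> c -` {i}) \<le> k" unfolding N_def by blast
  qed
  then have "cf_chromatic_number k (intersection_graph S) \<le> card (c ` S)" by (rule cf_chromatic_number_le)
  also have "\<dots> \<le> card {..<m}" using c(1) by (intro card_mono) auto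
  finally show ?thesis using c(2) by simp
qed

section \<open>L-shapes and frames\<close>

definition lshape :: "real \<Rightarrow> real \<Rightarrow> real \<Rightarrow> real \<Rightarrow> plane set" where
  "lshape x x' y0 y1 = {x} \<times> {y0..y1} \<union> {x..x'} \<times> {y0}"

definition frame :: "real \<Rightarrow> real \<Rightarrow> real \<Rightarrow> real \<Rightarrow> plane set" where
  "frame a b c d = {a, b} \<times> {c..d} \<union> {a..b} \<times> {c, d}"

lemma frontier_box_eq_frame:
  assumes "a < b" "c < d"
  shows "frontier ({a..b} \<times> {c..d}) = frame a b c d"
proof -
  have "closure ({a..b} \<times> {c..d}) = {a..b} \<times> {c..d}"
    by (intro closure_closed closed_Times) auto
  moreover have "interior ({a..b} \<times> {c..d}) = {a<..<b} \<times> {c<..<d}"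
    by (simp add: interior_Times)
  ultimately show ?thesis using assms unfolding frontier_def frame_def by auto
qed

lemma L_shapes_eq: "L_shapes = {lshape x x' y0 y1 | x x' y0 y1. y0 < y1 \<and> x < x'}"
  by (simp add: L_shapes_def lshape_def)

lemma frames_eq: "frames = {frame a b c d | a b c d. a < b \<and> c < d}"
  unfolding frames_def using frontier_box_eq_frame by metis

text \<open>The corner of an L-shape lies on both of its segments. If two vertical segments overlap,
  the higher of the two corners lies on the other vertical segment; if two horizontal ones overlap,
  the right one of the corners lies on the other horizontal segment. So every contact reduces to a
  vertical segment meeting a horizontal one.\<close>

lemma lshape_meet:
  assumes "y0 < y1" "x < x'" "w0 < w1" "u < u'"
  shows "lshape x x' y0 y1 \<inter> lshape u u' w0 w1 \<noteq> {} \<longleftrightarrow>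
    (x \<le> u \<and> u \<le> x' \<and> w0 \<le> y0 \<and> y0 \<le> w1) \<or> (u \<le> x \<and> x \<le> u' \<and> y0 \<le> w0 \<and> w0 \<le> y1)"
    (is "_ \<longleftrightarrow> ?r")
proof
  assume "lshape x x' y0 y1 \<inter> lshape u u' w0 w1 \<noteq> {}"
  then obtain p r where "(p, r) \<in> lshape x x' y0 y1" "(p, r) \<in> lshape u u' w0 w1" by auto
  then show ?r using assms unfolding lshape_def by auto
next
  assume ?r
  then have "(u, y0) \<in> lshape x x' y0 y1 \<inter> lshape u u' w0 w1 \<or>
      (x, w0) \<in> lshape x x' y0 y1 \<inter> lshape u u' w0 w1"
    using assms unfolding lshape_def by auto
  then show "lshape x x' y0 y1 \<inter> lshape u u' w0 w1 \<noteq> {}" by blast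
qed

lemma frame_meet:
  assumes "a < b" "c < d" "a' < b'" "c' < d'"
  shows "frame a b c d \<inter> frame a' b' c' d' \<noteq> {} \<longleftrightarrow>
    (\<exists>x\<in>{a', b'}. \<exists>y\<in>{c, d}. a \<le> x \<and> x \<le> b \<and> c' \<le> y \<and> y \<le> d') \<or>
    (\<exists>x\<in>{a, b}. \<exists>y\<in>{c', d'}. a' \<le> x \<and> x \<le> b' \<and> c \<le> y \<and> y \<le> d)" (is "_ \<longleftrightarrow> ?r")
proof
  assume "frame a b c d \<inter> frame a' b' c' d' \<noteq> {}"
  then obtain p r where "(p, r) \<in> frame a b c d" "(p, r) \<in> frame a' b' c' d'" by auto
  then have *: "(p = a \<or> p = b) \<and> c \<le> r \<and> r \<le> d \<or> a \<le> p \<and> p \<le> b \<and> (r = c \<or> r = d)"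
    "(p = a' \<or> p = b') \<and> c' \<le> r \<and> r \<le> d' \<or> a' \<le> p \<and> p \<le> b' \<and> (r = c' \<or> r = d')"
    unfolding frame_def by auto
  \<comment> \<open>If two collinear sides overlap, an endpoint of one lies on the other.\<close>
  have iv: "l \<le> l' \<and> l' \<le> h \<or> l' \<le> l \<and> l \<le> h'" if "l \<le> t" "t \<le> h" "l' \<le> t" "t \<le> h'" for l h l' h' t :: real
    using that by linarith
  show ?r using * iv[of c r d c' d'] iv[of a p b a' b'] assms by (elim conjE disjE) auto
next
  assume ?r
  then obtain x y where
    "x \<in> {a', b'} \<and> y \<in> {c, d} \<and> a \<le> x \<and> x \<le> b \<and> c' \<le> y \<and> y \<le> d' \<or>
     x \<in> {a, b} \<and> y \<in> {c', d'} \<and> a' \<le> x \<and> x \<le> b' \<and> c \<le> y \<and> y \<le> d" by blast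
  then have "(x, y) \<in> frame a b c d \<inter> frame a' b' c' d'"
    using assms unfolding frame_def by auto
  then show "frame a b c d \<inter> frame a' b' c' d' \<noteq> {}" by blast
qed

section \<open>Lower bound\<close>

text \<open>The color \<open>i\<close> supplied by \<open>cf\<close> for the whole interval misses
  one of the \<open>k + 1\<close> blocks. That block shows \<open>t\<close> colors by induction, and
  \<open>i\<close> is one more.\<close>

lemma interval_coloring_many_colors:
  fixes g :: "nat \<Rightarrow> nat"
  assumes cf: "\<And>a l. l > 0 \<Longrightarrow> a + l \<le> m \<Longrightarrow>
      \<exists>i. 1 \<le> card ({a..<a + l} \<inter> g -` {i}) \<and> card ({a..<a + l} \<inter> g -` {i}) \<le> k"
  shows "a + (k + 1) ^ t \<le> m \<Longrightarrow> t \<le> card (g ` {a..<a + (k + 1) ^ t})"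
proof (induction t arbitrary: a)
  case 0
  then show ?case by simp
next
  case (Suc t)
  define W where "W = (k + 1) ^ t"
  have W: "W > 0" by (simp add: W_def)
  let ?I = "{a..<a + (k + 1) * W}"
  have sz: "a + (k + 1) * W \<le> m" using Suc.prems by (simp add: W_def)
  obtain i where i: "1 \<le> card (?I \<inter> g -` {i})" "card (?I \<inter> g -` {i}) \<le> k"
    using cf[of "(k + 1) * W" a] sz W by auto
  let ?B = "\<lambda>j. {a + j * W..<a + j * W + W}"
  have sub: "?B j \<subseteq> ?I" if "j \<le> k" for j
  proof -
    have "(j + 1) * W \<le> (k + 1) * W" using that by (intro mult_le_mono1) simp
    then show ?thesis by auto
  qed
  have "\<exists>j\<le>k. i \<notin> g ` ?B j"
  proof (rule ccontr)
    assume "\<not> ?thesis"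
    then have "\<forall>j\<in>{..k}. \<exists>p. p \<in> ?B j \<and> g p = i" by blast
    then obtain p where p: "\<And>j. j \<le> k \<Longrightarrow> p j \<in> ?B j \<and> g (p j) = i"
      using bchoice[of "{..k}" "\<lambda>j p. p \<in> ?B j \<and> g p = i"] by auto
    \<comment> \<open>The block number can be recovered from the point, so one point of color
      \<open>i\<close> in each block would give \<open>k + 1\<close> distinct ones.\<close>
    have "(p j - a) div W = j" if "j \<le> k" for j
    proof (rule div_nat_eqI)
      show "W * j \<le> p j - a" "p j - a < W * Suc j" using p[OF that] by (auto simp: algebra_simps)
    qed
    then have "inj_on p {..k}" by (intro inj_on_inverseI[of _ "\<lambda>x. (x - a) div W"]) simp
    then have "card (p ` {..k}) = k + 1" by (simp add: card_image)
    moreover have "p ` {..k} \<subseteq> ?I \<inter> g -` {i}" using p sub by blast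
    then have "card (p ` {..k}) \<le> card (?I \<inter> g -` {i})" by (intro card_mono) auto
    ultimately show False using i by simp
  qed
  then obtain j where j: "j \<le> k" "i \<notin> g ` ?B j" by blast
  have "a + j * W + W \<le> a + (k + 1) * W" using sub[OF j(1)] W by auto
  then have "t \<le> card (g ` ?B j)" using Suc.IH[of "a + j * W"] sz unfolding W_def by linarith
  then have "Suc t \<le> card (insert i (g ` ?B j))" using j by simp
  also have "\<dots> \<le> card (g ` ?I)"
  proof (intro card_mono)
    have "?I \<inter> g -` {i} \<noteq> {}" using i(1) by (metis card.empty not_one_le_zero)
    then show "insert i (g ` ?B j) \<subseteq> g ` ?I" using sub[OF j(1)] by blast
  qed simp
  finally show ?case by (simp add: W_def)
qed

text \<open>A lower bound on the least value has to come from a coloring attaining it; an injective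
  coloring ensures that one exists.\<close>

lemma cf_chromatic_number_ge:
  assumes "finite S" "k \<ge> 1"
    and "\<And>c. cf_coloring k (intersection_graph S) c \<Longrightarrow> t \<le> card (c ` S)"
  shows "t \<le> cf_chromatic_number k (intersection_graph S)"
proof -
  obtain c :: "'a set \<Rightarrow> nat" where "inj_on c S"
    using finite_imp_inj_to_nat_seg[OF assms(1)] by blast
  then have "\<exists>m c. cf_coloring k (intersection_graph S) c \<and> card (c ` fst (intersection_graph S)) = m"
    using inj_cf_coloring[OF assms(1,2)] by blast
  from LeastI_ex[OF this] obtain c where c: "cf_coloring k (intersection_graph S) c"
    "card (c ` fst (intersection_graph S)) = cf_chromatic_number k (intersection_graph S)"
    unfolding cf_chromatic_number_def[symmetric] by blast
  show ?thesis using assms(3)[OF c(1)] c(2) by (simp add: intersection_graph_def)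
qed

text \<open>\<open>P a\<close> plays the role of the point \<open>a\<close> of a line, and \<open>I e\<close> that of the interval from
  \<open>e div m\<close> to \<open>e div m + e mod m\<close>.\<close>

lemma point_interval_lower_bound:
  fixes P I :: "nat \<Rightarrow> 'p set"
  assumes \<F>: "range P \<subseteq> \<F>" "range I \<subseteq> \<F>" "{} \<notin> \<F>"
    and PP: "\<And>a b. a \<noteq> b \<Longrightarrow> P a \<inter> P b = {}"
    and II: "\<And>e e'. e \<noteq> e' \<Longrightarrow> I e \<inter> I e' = {}"
    and PI: "\<And>a e. P a \<noteq> I e"
    and meet: "\<And>a e. e < m * m \<Longrightarrow> P a \<inter> I e \<noteq> {} \<longleftrightarrow> e div m \<le> a \<and> a \<le> e div m + e mod m"
    and k: "k \<ge> 1" and t: "(k + 1) ^ t \<le> m" and n: "m * m + m \<le> n"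
  shows "\<exists>S\<subseteq>\<F>. finite S \<and> card S = n \<and> t \<le> cf_chromatic_number k (intersection_graph S)"
proof -
  \<comment> \<open>The family must have exactly \<open>n\<close> members, so points with index at
    least \<open>m\<close> pad it. They meet none of the intervals considered below, which end
    before \<open>m\<close>.\<close>
  define N where "N = n - m * m"
  have N: "m \<le> N" "N + m * m = n" using n by (auto simp: N_def)
  define S where "S = P ` {..<N} \<union> I ` {..<m * m}"
  have injP: "inj P" using PP \<F> by (intro injI) (metis Int_absorb rangeI subsetD)
  have injI: "inj I" using II \<F> by (intro injI) (metis Int_absorb rangeI subsetD)
  have "card S = card (P ` {..<N}) + card (I ` {..<m * m})"
    unfolding S_def using PI by (intro card_Un_disjoint) auto
  also have "\<dots> = n" using N injP injI by (simp add: card_image inj_on_subset)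
  finally have "card S = n" .
  moreover have finS: "finite S" by (simp add: S_def)
  moreover have "S \<subseteq> \<F>" using \<F> by (auto simp: S_def)
  moreover have "t \<le> cf_chromatic_number k (intersection_graph S)"
  proof (rule cf_chromatic_number_ge[OF finS k])
    fix c assume c: "cf_coloring k (intersection_graph S) c"
    have "\<exists>i. 1 \<le> card ({a..<a + l} \<inter> (c \<circ> P) -` {i}) \<and> card ({a..<a + l} \<inter> (c \<circ> P) -` {i}) \<le> k"
      if l: "l > 0" "a + l \<le> m" for a l
    proof -
      \<comment> \<open>The interval formed by the \<open>l\<close> points from \<open>a\<close>
        ends at \<open>a + l - 1\<close>, so the encoded length is \<open>l - 1\<close>, a valid
        remainder modulo \<open>m\<close>.\<close>
      define e where "e = a * m + (l - 1)"
      have lm: "l - 1 < m" using l by simp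
      have "e < (a + 1) * m" using lm by (simp add: e_def)
      also have "\<dots> \<le> m * m" using l by (intro mult_le_mono1) simp
      finally have e: "e < m * m" .
      have dm: "e div m = a" "e mod m = l - 1" using lm by (auto simp: e_def)
      have IS: "I e \<in> S" using e by (simp add: S_def)
      let ?N = "neighborhood (intersection_graph S) (I e)"
      have "?N = P ` {a..<a + l}"
      proof (intro equalityI subsetI)
        fix B assume "B \<in> ?N"
        then have B: "B \<in> S" "B \<noteq> I e" "I e \<inter> B \<noteq> {}"
          by (auto simp: neighborhood_intersection_graph[OF IS])
        have "B \<notin> range I"
        proof
          assume "B \<in> range I"
          then obtain e' where e': "B = I e'" by blast
          then have "e \<noteq> e'" using B(2) by auto
          then show False using II B(3) e' by blast
        qed
        then obtain b where b: "B = P b" using B(1) by (auto simp: S_def)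
        then have "a \<le> b \<and> b \<le> a + (l - 1)" using meet[OF e, of b] B(3) dm by (simp add: Int_commute)
        then show "B \<in> P ` {a..<a + l}" using b l by auto
      next
        fix B assume "B \<in> P ` {a..<a + l}"
        then obtain b where b: "B = P b" "a \<le> b" "b < a + l" by auto
        then have "I e \<inter> B \<noteq> {}" using meet[OF e, of b] dm by (simp add: Int_commute)
        moreover have "B \<in> S" using b l N by (simp add: S_def)
        ultimately show "B \<in> ?N" using b PI[of b e] by (simp add: neighborhood_intersection_graph[OF IS])
      qed
      moreover have "P ` {a..<a + l} \<inter> c -` {i} = P ` ({a..<a + l} \<inter> (c \<circ> P) -` {i})" for i by auto
      ultimately have card: "card (?N \<inter> c -` {i}) = card ({a..<a + l} \<inter> (c \<circ> P) -` {i})" for i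
        using injP by (simp add: card_image inj_on_subset)
      have "?N \<noteq> {}" using \<open>?N = P ` {a..<a + l}\<close> l by simp
      then have "\<exists>i. 1 \<le> card (?N \<inter> c -` {i}) \<and> card (?N \<inter> c -` {i}) \<le> k"
        using c IS unfolding cf_coloring_def by (simp add: intersection_graph_def)
      then show ?thesis unfolding card .
    qed
    then have "t \<le> card ((c \<circ> P) ` {0..<0 + (k + 1) ^ t})"
      by (rule interval_coloring_many_colors) (use t in simp_all)
    also have "\<dots> \<le> card (c ` S)"
      using t N finS by (intro card_mono) (auto simp: S_def)
    finally show "t \<le> card (c ` S)" .
  qed
  ultimately show ?thesis by blast
qed

text \<open>Points are tall L-shapes at integer abscissas with a foot of width 1/4. Intervals are
  flat L-shapes of height 1/2, the \<open>e\<close>-th based at height \<open>e + 1\<close>, so that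
  different ones are disjoint and all lie above the feet. They overhang their end points by only
  1/2, hence they reach no tall shape outside the interval. For \<open>e < m * m\<close> the base
  stays below the top of the tall shapes, and the crossing point is
  \<open>(a, e + 1)\<close>.\<close>

lemma L_shapes_lower_bound:
  assumes "k \<ge> 1" "(k + 1) ^ t \<le> m" "m * m + m \<le> n"
  shows "\<exists>S\<subseteq>L_shapes. finite S \<and> card S = n \<and> t \<le> cf_chromatic_number k (intersection_graph S)"
proof -
  define P where "P a = lshape (real a) (real a + 1 / 4) 0 (real (m * m) + 1)" for a
  define I where "I e = lshape (real (e div m) - 1 / 2) (real (e div m + e mod m) + 1 / 2) (real e + 1) (real e + 3 / 2)" for e
  have m: "0 < real (m * m) + 1" by linarith
  show ?thesis
  proof (rule point_interval_lower_bound[OF _ _ _ _ _ _ _ assms])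
    show "range P \<subseteq> L_shapes" unfolding L_shapes_eq P_def using m by fastforce
    have "real (e div m) - 1 / 2 < real (e div m + e mod m) + 1 / 2" for e by simp
    then show "range I \<subseteq> L_shapes" unfolding L_shapes_eq I_def by fastforce
    show "{} \<notin> L_shapes" by (auto simp: L_shapes_eq lshape_def)
    show "P a \<inter> P b = {}" if "a \<noteq> b" for a b
    proof -
      have "real a + 1 \<le> real b \<or> real b + 1 \<le> real a" using that by linarith
      then show ?thesis unfolding P_def lshape_def by auto
    qed
    show "I e \<inter> I e' = {}" if "e \<noteq> e'" for e e'
    proof -
      have "real e + 1 \<le> real e' \<or> real e' + 1 \<le> real e" using that by linarith
      then show ?thesis unfolding I_def lshape_def by auto
    qed
    show "P a \<noteq> I e" for a e
    proof -
      have "(real a, 0) \<in> P a" "(real a, 0) \<notin> I e" using m by (auto simp: P_def I_def lshape_def)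
      then show ?thesis by blast
    qed
    show "P a \<inter> I e \<noteq> {} \<longleftrightarrow> e div m \<le> a \<and> a \<le> e div m + e mod m" if "e < m * m" for a e
    proof
      assume "e div m \<le> a \<and> a \<le> e div m + e mod m"
      then have "real (e div m) \<le> real a" "real a \<le> real (e div m + e mod m)" by linarith+
      moreover have "real e + 1 \<le> real (m * m)" using that by linarith
      ultimately have "(real a, real e + 1) \<in> P a \<inter> I e"
        unfolding P_def I_def lshape_def by (auto simp del: of_nat_add of_nat_mult)
      then show "P a \<inter> I e \<noteq> {}" by blast
    next
      assume "P a \<inter> I e \<noteq> {}"
      then obtain x y where "(x, y) \<in> P a" "(x, y) \<in> I e" by auto
      then have "real a \<le> x" "x \<le> real a + 1 / 4" "real (e div m) - 1 / 2 \<le> x" "x \<le> real (e div m + e mod m) + 1 / 2"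
        unfolding P_def I_def lshape_def by (auto simp del: of_nat_add of_nat_mult)
      then show "e div m \<le> a \<and> a \<le> e div m + e mod m" by linarith
    qed
  qed
qed

text \<open>The frames are the boundaries of the bounding boxes of the L-shapes in
  \<open>L_shapes_lower_bound\<close>; the same crossing points and the same separations
  work.\<close>

lemma frames_lower_bound:
  assumes "k \<ge> 1" "(k + 1) ^ t \<le> m" "m * m + m \<le> n"
  shows "\<exists>S\<subseteq>frames. finite S \<and> card S = n \<and> t \<le> cf_chromatic_number k (intersection_graph S)"
proof -
  define P where "P a = frame (real a) (real a + 1 / 4) 0 (real (m * m) + 1)" for a
  define I where "I e = frame (real (e div m) - 1 / 2) (real (e div m + e mod m) + 1 / 2) (real e + 1) (real e + 3 / 2)" for e
  have lt: "real (e div m) - 1 / 2 < real (e div m + e mod m) + 1 / 2" for e by simp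
  show ?thesis
  proof (rule point_interval_lower_bound[OF _ _ _ _ _ _ _ assms])
    have "0 < real (m * m) + 1" by linarith
    then show "range P \<subseteq> frames" unfolding frames_eq P_def by fastforce
    show "range I \<subseteq> frames" unfolding frames_eq I_def using lt by fastforce
    show "{} \<notin> frames" by (auto simp: frames_eq frame_def)
    show "P a \<inter> P b = {}" if "a \<noteq> b" for a b
    proof -
      have "real a + 1 \<le> real b \<or> real b + 1 \<le> real a" using that by linarith
      then show ?thesis unfolding P_def frame_def by auto
    qed
    show "I e \<inter> I e' = {}" if "e \<noteq> e'" for e e'
    proof -
      have "real e + 1 \<le> real e' \<or> real e' + 1 \<le> real e" using that by linarith
      then show ?thesis unfolding I_def frame_def by auto
    qed
    show "P a \<noteq> I e" for a e
    proof -
      have "(real a, 0) \<in> P a" "(real a, 0) \<notin> I e" by (auto simp: P_def I_def frame_def)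
      then show ?thesis by blast
    qed
    show "P a \<inter> I e \<noteq> {} \<longleftrightarrow> e div m \<le> a \<and> a \<le> e div m + e mod m" if "e < m * m" for a e
    proof
      assume "e div m \<le> a \<and> a \<le> e div m + e mod m"
      then have "real (e div m) \<le> real a" "real a \<le> real (e div m + e mod m)" by linarith+
      moreover have "real e + 1 \<le> real (m * m)" using that by linarith
      ultimately have "(real a, real e + 1) \<in> P a \<inter> I e"
        unfolding P_def I_def frame_def by (auto simp del: of_nat_add of_nat_mult)
      then show "P a \<inter> I e \<noteq> {}" by blast
    next
      assume "P a \<inter> I e \<noteq> {}"
      then obtain x y where "(x, y) \<in> P a" "(x, y) \<in> I e" by auto
      then have "real a \<le> x" "x \<le> real a + 1 / 4" "real (e div m) - 1 / 2 \<le> x" "x \<le> real (e div m + e mod m) + 1 / 2"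
        unfolding P_def I_def frame_def by (auto simp del: of_nat_add of_nat_mult)
      then show "e div m \<le> a \<and> a \<le> e div m + e mod m" by linarith
    qed
  qed
qed

section \<open>Asymptotics\<close>

text \<open>An L-shape has one side in each direction, so \<open>q = 1\<close>: this needs
  \<open>k \<ge> 2\<close>, and \<open>32 * 1 * 3^2 + 2 = 290\<close>.\<close>

lemma L_shapes_upper_bound:
  assumes "S \<subseteq> L_shapes" "finite S" "k \<ge> 2"
  shows "real (cf_chromatic_number k (intersection_graph S)) \<le> 1 + ln (card S) / ln (290 / 289)"
proof -
  have "\<forall>A. \<exists>x x' y0 y1. A \<in> L_shapes \<longrightarrow> A = lshape x x' y0 y1 \<and> y0 < y1 \<and> x < x'"
    by (auto simp: L_shapes_eq)
  then obtain x x' y0 y1 where L: "\<And>A. A \<in> L_shapes \<Longrightarrow> A = lshape (x A) (x' A) (y0 A) (y1 A)"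
    "\<And>A. A \<in> L_shapes \<Longrightarrow> y0 A < y1 A" "\<And>A. A \<in> L_shapes \<Longrightarrow> x A < x' A" by metis
  have "A \<inter> B \<noteq> {} \<longleftrightarrow> (\<exists>s<1::nat. \<exists>t<1::nat.
        x A \<le> x B \<and> x B \<le> x' A \<and> y0 B \<le> y0 A \<and> y0 A \<le> y1 B \<or>
        x B \<le> x A \<and> x A \<le> x' B \<and> y0 A \<le> y0 B \<and> y0 B \<le> y1 A)" if "A \<in> S" "B \<in> S" for A B
  proof -
    have AB: "A \<in> L_shapes" "B \<in> L_shapes" using that assms(1) by auto
    have "A \<inter> B \<noteq> {} \<longleftrightarrow>
        x A \<le> x B \<and> x B \<le> x' A \<and> y0 B \<le> y0 A \<and> y0 A \<le> y1 B \<or>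
        x B \<le> x A \<and> x A \<le> x' B \<and> y0 A \<le> y0 B \<and> y0 B \<le> y1 A"
      using lshape_meet[OF L(2)[OF AB(1)] L(3)[OF AB(1)] L(2)[OF AB(2)] L(3)[OF AB(2)]]
      unfolding L(1)[OF AB(1), symmetric] L(1)[OF AB(2), symmetric] .
    then show ?thesis by (simp only: less_one) blast
  qed
  from cf_chromatic_number_rectilinear[OF assms(2), of 1 k, OF _ this] show ?thesis
    using assms(3) by simp
qed

text \<open>A frame has two sides in each direction, so \<open>q = 2\<close>: this needs
  \<open>k \<ge> 4\<close>, and \<open>32 * 2 * 4^2 + 2 = 1026\<close>.\<close>

lemma frames_upper_bound:
  assumes "S \<subseteq> frames" "finite S" "k \<ge> 4"
  shows "real (cf_chromatic_number k (intersection_graph S)) \<le> 1 + ln (card S) / ln (1026 / 1025)"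
proof -
  have "\<forall>A. \<exists>a b c d. A \<in> frames \<longrightarrow> A = frame a b c d \<and> a < b \<and> c < d"
    by (auto simp: frames_eq)
  then obtain a b c d where F: "\<And>A. A \<in> frames \<Longrightarrow> A = frame (a A) (b A) (c A) (d A)"
    "\<And>A. A \<in> frames \<Longrightarrow> a A < b A" "\<And>A. A \<in> frames \<Longrightarrow> c A < d A" by metis
  define vx where "vx A s = (if s = 0 then a A else b A)" for A and s :: nat
  define hy where "hy A s = (if s = 0 then c A else d A)" for A and s :: nat
  have vx: "(\<exists>x\<in>{a A, b A}. Q x) \<longleftrightarrow> (\<exists>s<2. Q (vx A s))" for A Q
    by (auto simp: less_2_cases_iff vx_def)
  have hy: "(\<exists>y\<in>{c A, d A}. Q y) \<longleftrightarrow> (\<exists>s<2. Q (hy A s))" for A Q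
    by (auto simp: less_2_cases_iff hy_def)
  have "A \<inter> B \<noteq> {} \<longleftrightarrow> (\<exists>s<2. \<exists>t<2.
        a A \<le> vx B s \<and> vx B s \<le> b A \<and> c B \<le> hy A t \<and> hy A t \<le> d B \<or>
        a B \<le> vx A t \<and> vx A t \<le> b B \<and> c A \<le> hy B s \<and> hy B s \<le> d A)" if "A \<in> S" "B \<in> S" for A B
  proof -
    have AB: "A \<in> frames" "B \<in> frames" using that assms(1) by auto
    have "A \<inter> B \<noteq> {} \<longleftrightarrow>
        (\<exists>x\<in>{a B, b B}. \<exists>y\<in>{c A, d A}. a A \<le> x \<and> x \<le> b A \<and> c B \<le> y \<and> y \<le> d B) \<or>
        (\<exists>x\<in>{a A, b A}. \<exists>y\<in>{c B, d B}. a B \<le> x \<and> x \<le> b B \<and> c A \<le> y \<and> y \<le> d A)"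
      using frame_meet[OF F(2)[OF AB(1)] F(3)[OF AB(1)] F(2)[OF AB(2)] F(3)[OF AB(2)]]
      unfolding F(1)[OF AB(1), symmetric] F(1)[OF AB(2), symmetric] .
    also have "\<dots> \<longleftrightarrow> (\<exists>s<2. \<exists>t<2.
        a A \<le> vx B s \<and> vx B s \<le> b A \<and> c B \<le> hy A t \<and> hy A t \<le> d B \<or>
        a B \<le> vx A t \<and> vx A t \<le> b B \<and> c A \<le> hy B s \<and> hy B s \<le> d A)"
      unfolding vx hy by blast
    finally show ?thesis .
  qed
  from cf_chromatic_number_rectilinear[OF assms(2), of 2 k, OF _ this] show ?thesis
    using assms(3) by simp
qed

lemma log_bigtheta:
  fixes f :: "nat \<Rightarrow> nat"
  assumes B: "B > 0" and upper: "\<And>n. n \<ge> 2 \<Longrightarrow> real (f n) \<le> 1 + ln (real n) / B"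
    and M: "M \<ge> 2" and lower: "\<And>n t. M ^ t * M ^ t + M ^ t \<le> n \<Longrightarrow> t \<le> f n"
  shows "(\<lambda>n. real (f n)) \<in> \<Theta>(\<lambda>n. ln (real n))"
proof (rule bigthetaI)
  \<comment> \<open>From 3 on, which exceeds e, the logarithm is at least 1 and absorbs the additive
    constant.\<close>
  have "eventually (\<lambda>n. norm (real (f n)) \<le> (1 + 1 / B) * norm (ln (real n))) at_top"
    using eventually_ge_at_top[of 3]
  proof eventually_elim
    case (elim n)
    have "1 \<le> ln (real n)" using elim exp_le by (subst ln_ge_iff) auto
    then show ?case using upper[of n] elim by (simp add: algebra_simps)
  qed
  then show "(\<lambda>n. real (f n)) \<in> O(\<lambda>n. ln (real n))" by (rule bigoI)
next
  \<comment> \<open>Choose \<open>t\<close> with \<open>n\<close> between \<open>M^(3*t)\<close> and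
    \<open>M^(3*(t+1))\<close>. The exponent 3 leaves room for \<open>M^(2*t) + M^t\<close>, so
    \<open>t \<le> f n\<close>. Since \<open>n \<ge> M^3\<close> gives \<open>t \<ge> 1\<close>, the
    logarithm of \<open>n\<close> is at most
    \<open>3 * (t + 1) * ln M \<le> 6 * t * ln M\<close>.\<close>
  define c where "c = 1 / (6 * ln (real M))"
  have lnM: "ln (real M) > 0" using M by simp
  have "eventually (\<lambda>n. norm (real (f n)) \<ge> c * norm (ln (real n))) at_top"
    using eventually_ge_at_top[of "M ^ 3"]
  proof eventually_elim
    case (elim n)
    have M3: "M ^ 3 \<ge> 2" using M self_le_power[of M 3] by linarith
    then obtain t where t: "(M ^ 3) ^ t \<le> n" "n < (M ^ 3) ^ (t + 1)"
      using ex_power_ivl1[of "M ^ 3" n] elim by auto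
    have n: "n \<ge> 1" using elim M3 by linarith
    have t1: "t \<ge> 1" using t(2) elim by (cases t) auto
    define x where "x = M ^ t"
    have x: "x \<ge> 2" using M t1 self_le_power[of M t] unfolding x_def by linarith
    have "x * x + x \<le> x * x * 2" using x by (simp add: mult_2_right)
    also have "\<dots> \<le> x * x * x" using x by (intro mult_le_mono2)
    also have "\<dots> = (M ^ 3) ^ t" by (simp add: x_def power3_eq_cube power_mult_distrib)
    finally have "t \<le> f n" using t(1) by (intro lower) (simp add: x_def)
    have "ln (real n) \<le> ln (real ((M ^ 3) ^ (t + 1)))"
      using t(2) n M by (subst ln_le_cancel_iff) (simp_all del: power_Suc of_nat_power)
    also have "\<dots> = real (t + 1) * (3 * ln (real M))"
      using M by (simp add: ln_realpow del: power_Suc)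
    also have "\<dots> \<le> real (2 * t) * (3 * ln (real M))"
      using t1 lnM by (intro mult_right_mono) auto
    finally have "c * ln (real n) \<le> real t" using lnM by (simp add: c_def field_simps)
    then show ?case using \<open>t \<le> f n\<close> n by simp
  qed
  then show "(\<lambda>n. real (f n)) \<in> \<Omega>(\<lambda>n. ln (real n))"
    using lnM by (intro landau_omega.bigI[of c]) (auto simp: c_def)
qed

lemma max_cf_chromatic_number_bigtheta:
  assumes k: "k \<ge> 1" and B: "B > 0"
    and upper: "\<And>S. S \<subseteq> \<F> \<Longrightarrow> finite S \<Longrightarrow> real (cf_chromatic_number k (intersection_graph S)) \<le> 1 + ln (card S) / B"
    and lower: "\<And>n m t. (k + 1) ^ t \<le> m \<Longrightarrow> m * m + m \<le> n \<Longrightarrow>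
      \<exists>S\<subseteq>\<F>. finite S \<and> card S = n \<and> t \<le> cf_chromatic_number k (intersection_graph S)"
  shows "(\<lambda>n. real (max_cf_chromatic_number \<F> k n)) \<in> \<Theta>(\<lambda>n. ln (real n))"
proof (rule log_bigtheta[OF B, of _ "k + 1"])
  fix n :: nat
  let ?X = "{cf_chromatic_number k (intersection_graph S) | S. S \<subseteq> \<F> \<and> finite S \<and> card S = n}"
  have fin: "finite ?X" by (rule finite_cf_chromatic_numbers[OF k])
  show "real (max_cf_chromatic_number \<F> k n) \<le> 1 + ln (real n) / B" if "n \<ge> 2"
  proof -
    \<comment> \<open>The maximum is meaningful only if the class has a family of size
      \<open>n\<close>; the lower bound construction with \<open>t = 0\<close> and
      \<open>m = 1\<close> provides one once \<open>n \<ge> 2\<close>.\<close>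
    have "?X \<noteq> {}" using lower[of 0 1 n] that by auto
    then have "Max ?X \<in> ?X" using fin by (intro Max_in)
    then show ?thesis using upper unfolding max_cf_chromatic_number_def by auto
  qed
  show "t \<le> max_cf_chromatic_number \<F> k n" if "(k + 1) ^ t * (k + 1) ^ t + (k + 1) ^ t \<le> n" for t
  proof -
    from lower[OF order_refl that] obtain S where "S \<subseteq> \<F>" "finite S" "card S = n"
      "t \<le> cf_chromatic_number k (intersection_graph S)" by blast
    then have "cf_chromatic_number k (intersection_graph S) \<le> Max ?X" using fin by (intro Max_ge) auto
    then show ?thesis using \<open>t \<le> _\<close> unfolding max_cf_chromatic_number_def by linarith
  qed
qed (use k in simp)

theorem theorem3:
  shows "(\<forall>k \<ge> 2. (\<lambda>n. real (max_cf_chromatic_number L_shapes k n)) \<in> \<Theta>(\<lambda>n. ln (real n))) \<and>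
         (\<forall>k \<ge> 4. (\<lambda>n. real (max_cf_chromatic_number frames k n)) \<in> \<Theta>(\<lambda>n. ln (real n)))"
proof (intro conjI allI impI)
  fix k :: nat assume "k \<ge> 2"
  then show "(\<lambda>n. real (max_cf_chromatic_number L_shapes k n)) \<in> \<Theta>(\<lambda>n. ln (real n))"
    by (intro max_cf_chromatic_number_bigtheta[where B = "ln (290 / 289)"] L_shapes_upper_bound L_shapes_lower_bound) auto
next
  fix k :: nat assume "k \<ge> 4"
  then show "(\<lambda>n. real (max_cf_chromatic_number frames k n)) \<in> \<Theta>(\<lambda>n. ln (real n))"
    by (intro max_cf_chromatic_number_bigtheta[where B = "ln (1026 / 1025)"] frames_upper_bound frames_lower_bound) auto
qed

end
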